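(* For every $\epsilon > 0$ there is a constant $C_\epsilon > 0$ such that the following holds. Let $N \geq 1$ be real and let $\alpha$ be a real number such that $|\alpha - \frac{a}{q}| \leq \frac{1}{q N^{3/2}}$ for some integers $a$ and $q$ with $1 \leq q \leq N^{3/2}$ and $(a,q)=1$. Then there exist integers $a_1, a_2$ and integers $1 \leq q_1, q_2 \leq N$ such that $$\Big|\alpha - \frac{a_1}{q_1} - \frac{a_2}{q_2}\Big| \leq \frac{C_\epsilon}{q N^{3/2 - \epsilon}}.$$ *)

theory Defs
  imports Complex_Main
begin

end

theory Submission
  imports Defs "HOL-Computational_Algebra.Primes" "HOL-Analysis.Kronecker_Approximation_Theorem"
    "HOL-Real_Asymp.Real_Asymp"
begin

text \<open>If \<open>q \<le> N\<close>, the fraction \<open>a / q\<close> itself will do. Otherwise let \<open>D\<close> be about \<open>N\<^sup>1\<^sup>-\<^sup>\<delta>\<close> and \<open>M\<close> about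
  \<open>N\<^sup>2\<^sup>-\<^sup>2\<^sup>\<delta>\<close>. For each prime \<open>p\<close> in \<open>(D, N]\<close>, Dirichlet's theorem applied to \<open>p a / q\<close> gives \<open>k \<le> D\<close> and \<open>h\<close>
  with \<open>\<bar>p k a / q - h\<bar> < 1 / D\<close>; as \<open>p\<close> and \<open>k\<close> are coprime, \<open>h / (p k)\<close> is a sum of fractions with
  denominators \<open>p\<close> and \<open>k\<close>. The error \<open>1 / (D p k)\<close> is small enough once \<open>p k > M\<close>. If this fails for every
  \<open>p\<close>, the products \<open>p k\<close> are distinct integers \<open>m \<le> M\<close> for which \<open>a m\<close> is within \<open>q / D\<close> of a multiple of \<open>q\<close>.
  There are at most \<open>(M / q + 1) (2 q / D + 1)\<close>, hence \<open>O(N\<^sup>1\<^sup>-\<^sup>\<delta>)\<close>, of these, fewer than the primes in \<open>(D, N]\<close> by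
  the Chebyshev bound coming from the central binomial coefficient.\<close>

section \<open>Chebyshev's lower bound for the number of primes\<close>

lemma multiplicity_eq_card_power_dvd:
  fixes n p :: nat
  assumes "prime p" "n > 0" "multiplicity p n \<le> K"
  shows "multiplicity p n = card {k\<in>{1..K}. p ^ k dvd n}"
proof -
  have "{k\<in>{1..K}. p ^ k dvd n} = {1..multiplicity p n}"
    using assms by (auto simp: power_dvd_iff_le_multiplicity prime_nat_iff)
  then show ?thesis by simp
qed

text \<open>Legendre's formula, cut off at \<open>K\<close> because all later terms vanish. In the
  induction, passing from \<open>n\<close> to \<open>Suc n\<close> raises \<open>n div p ^ k\<close>
  by one exactly when \<open>p ^ k\<close> divides \<open>Suc n\<close>.\<close>

lemma multiplicity_fact:
  fixes n p :: nat
  assumes p: "prime p" and "n < p ^ Suc K"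
  shows "multiplicity p (fact n) = (\<Sum>k=1..K. n div p ^ k)"
  using assms(2)
proof (induction n)
  case (Suc n)
  have "p ^ multiplicity p (Suc n) < p ^ Suc K"
    using Suc.prems dvd_imp_le[OF multiplicity_dvd[of p "Suc n"]] by linarith
  then have "multiplicity p (Suc n) \<le> K"
    using prime_gt_1_nat[OF p] by (metis less_Suc_eq_le power_less_imp_less_exp)
  then have *: "multiplicity p (Suc n) = (\<Sum>k=1..K. if p ^ k dvd Suc n then 1 else 0)"
    by (subst multiplicity_eq_card_power_dvd[OF p]) (auto simp: sum.If_cases Int_def)
  have "multiplicity p (fact (Suc n)) = multiplicity p (Suc n) + multiplicity p (fact n :: nat)"
    using p by (simp add: prime_elem_multiplicity_mult_distrib del: mult_Suc)
  also have "\<dots> = (\<Sum>k=1..K. (if p ^ k dvd Suc n then 1 else 0) + n div p ^ k)"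
    using Suc * by (simp add: sum.distrib)
  also have "\<dots> = (\<Sum>k=1..K. Suc n div p ^ k)"
    by (rule sum.cong) (auto simp: div_Suc dvd_eq_mod_eq_0)
  finally show ?case .
qed simp

text \<open>By Legendre's formula the multiplicity is a sum of \<open>K\<close> differences
  \<open>2 * n div p ^ k - 2 * (n div p ^ k)\<close>, each of which is 0 or 1.\<close>

lemma multiplicity_central_binomial_le:
  fixes n p :: nat
  assumes p: "prime p" and n: "2 * n < p ^ Suc K"
  shows "multiplicity p (2 * n choose n) \<le> K"
proof -
  have "(fact (2 * n) :: nat) = fact n * fact n * (2 * n choose n)"
    using binomial_fact_lemma[of n "2 * n"] by (simp add: mult_2)
  then have "multiplicity p (fact (2 * n)) =
      2 * multiplicity p (fact n :: nat) + multiplicity p (2 * n choose n)"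
    using p by (simp add: prime_elem_multiplicity_mult_distrib)
  then have "2 * (\<Sum>k=1..K. n div p ^ k) + multiplicity p (2 * n choose n) = (\<Sum>k=1..K. 2 * n div p ^ k)"
    using multiplicity_fact[OF p, of "2 * n" K] multiplicity_fact[OF p, of n K] n by simp
  also have "\<dots> \<le> (\<Sum>k=1..K. 2 * (n div p ^ k) + 1)"
  proof (rule sum_mono)
    fix k
    have "2 * n < p ^ k * (2 * (n div p ^ k) + 2)"
      using dividend_less_times_div[of "p ^ k" n] prime_gt_0_nat[OF p] by (simp add: algebra_simps)
    then have "2 * n div p ^ k < 2 * (n div p ^ k) + 2"
      by (simp add: less_mult_imp_div_less mult.commute)
    then show "2 * n div p ^ k \<le> 2 * (n div p ^ k) + 1" by simp
  qed
  also have "\<dots> = 2 * (\<Sum>k=1..K. n div p ^ k) + K"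
    unfolding sum.distrib sum_distrib_left by simp
  finally show ?thesis by simp
qed

lemma prime_power_multiplicity_central_binomial_le:
  fixes n p :: nat
  assumes p: "prime p" and "n > 0"
  shows "p ^ multiplicity p (2 * n choose n) \<le> 2 * n"
proof (cases "multiplicity p (2 * n choose n)")
  case 0
  then show ?thesis using \<open>n > 0\<close> by simp
next
  case (Suc K)
  \<comment> \<open>If \<open>p ^ Suc K\<close> exceeded \<open>2 * n\<close>, the preceding bound
    would force \<open>Suc K \<le> K\<close>.\<close>
  with multiplicity_central_binomial_le[OF p, of n K] show ?thesis
    by (metis not_less not_less_eq_eq order_refl)
qed

text \<open>The central binomial coefficient is at least \<open>2 ^ n\<close>, and it is a product
  of prime powers, one for each of its prime factors, all at most \<open>2 * n\<close>.\<close>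

lemma two_power_le_power_card_primes:
  assumes "n > 0"
  shows "2 ^ n \<le> (2 * n) ^ card {p. prime p \<and> p \<le> 2 * n}"
proof -
  let ?c = "2 * n choose n"
  let ?P = "{p. prime p \<and> p \<le> 2 * n}"
  have c0: "?c > 0" by (simp add: zero_less_binomial_iff)
  have fin: "finite ?P" by (rule finite_subset[of _ "{..2 * n}"]) auto
  have sub: "prime_factors ?c \<subseteq> ?P"
  proof
    fix p assume p: "p \<in> prime_factors ?c"
    then have "prime p" by auto
    have "multiplicity p ?c \<noteq> 0"
      using p by (simp add: prime_factors_multiplicity)
    then have "p \<le> p ^ multiplicity p ?c"
      using \<open>prime p\<close> by (simp add: prime_gt_0_nat self_le_power Suc_le_eq)
    also have "\<dots> \<le> 2 * n"
      using prime_power_multiplicity_central_binomial_le[OF \<open>prime p\<close> assms] .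
    finally show "p \<in> ?P" using \<open>prime p\<close> by simp
  qed
  have "real (2 ^ n) \<le> real ?c"
    using binomial_ge_n_over_k_pow_k[of n "2 * n", where ?'a = real] assms by simp
  then have "2 ^ n \<le> ?c" by (simp only: of_nat_le_iff)
  also have "?c = (\<Prod>p\<in>prime_factors ?c. p ^ multiplicity p ?c)"
    using prime_factorization_nat[OF c0] .
  also have "\<dots> \<le> (\<Prod>p\<in>prime_factors ?c. 2 * n)"
    by (intro prod_mono) (auto intro: prime_power_multiplicity_central_binomial_le assms)
  also have "\<dots> = (2 * n) ^ card (prime_factors ?c)" by simp
  also have "\<dots> \<le> (2 * n) ^ card ?P"
    using assms by (intro power_increasing card_mono fin sub) simp
  finally show ?thesis .
qed

lemma card_primes_lower_bound:
  fixes x :: real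
  assumes "x \<ge> 2"
  shows "(x / 2 - 1) * ln 2 / ln x \<le> real (card {p :: nat. prime p \<and> real p \<le> x})"
proof -
  \<comment> \<open>Rounding \<open>x / 2\<close> down costs less than 1, whence the
    \<open>- 1\<close> in the bound.\<close>
  define n where "n = nat \<lfloor>x / 2\<rfloor>"
  have n: "n > 0" "2 * real n \<le> x" "x / 2 - 1 \<le> real n"
    using assms unfolding n_def by linarith+
  let ?P = "{p. prime p \<and> p \<le> 2 * n}" and ?Q = "{p :: nat. prime p \<and> real p \<le> x}"
  have "?P \<subseteq> ?Q" using n by auto
  moreover have "finite ?Q"
    by (rule finite_subset[of _ "{..nat \<lfloor>x\<rfloor>}"]) (auto simp: le_nat_floor)
  ultimately have le: "card ?P \<le> card ?Q" by (rule card_mono[rotated])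
  have "(2 :: real) ^ n \<le> (2 * real n) ^ card ?P"
    using two_power_le_power_card_primes[OF n(1)]
    by (metis (no_types, lifting) of_nat_le_iff of_nat_mult of_nat_numeral of_nat_power)
  then have "ln ((2 :: real) ^ n) \<le> ln ((2 * real n) ^ card ?P)"
    using n by (subst ln_le_cancel_iff) auto
  then have "real n * ln 2 \<le> real (card ?P) * ln (2 * real n)"
    using n by (subst (asm) (1 2) ln_realpow) auto
  also have "\<dots> \<le> real (card ?Q) * ln x"
    using le n by (intro mult_mono) (auto)
  finally have "(x / 2 - 1) * ln 2 \<le> real (card ?Q) * ln x"
    using n(3) by (smt (verit) ln_gt_zero mult_right_mono)
  then show ?thesis using assms by (simp add: divide_le_eq)
qed

section \<open>Counting multiples near zero modulo \<open>q\<close>, and Dirichlet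
  approximation\<close>

text \<open>Encode \<open>m\<close> by its block \<open>m div q\<close> and the offset of
  \<open>a * m\<close> from a nearby multiple of \<open>q\<close>. The offset fixes \<open>m\<close>
  modulo \<open>q\<close>, since \<open>a\<close> is invertible there, so the pair fixes
  \<open>m\<close>. There are at most \<open>M / q + 1\<close> blocks and \<open>2 * r + 1\<close>
  offsets.\<close>

lemma card_multiples_near_zero_mod:
  fixes a q :: int and M :: nat and r :: real
  assumes "coprime a q" "q > 0" "r \<ge> 0"
  defines "S \<equiv> {m \<in> {1..M}. \<exists>b. \<bar>real_of_int (a * int m - b * q)\<bar> \<le> r}"
  shows "real (card S) \<le> (M / q + 1) * (2 * r + 1)"
proof -
  define b where "b m = (SOME b. \<bar>real_of_int (a * int m - b * q)\<bar> \<le> r)" for m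
  have b: "\<bar>real_of_int (a * int m - b m * q)\<bar> \<le> r" if "m \<in> S" for m
    unfolding b_def by (rule someI_ex) (use that in \<open>auto simp: S_def\<close>)
  define f where "f m = (int m div q, a * int m - b m * q)" for m
  define T where "T = {0..int M div q} \<times> {-\<lfloor>r\<rfloor>..\<lfloor>r\<rfloor>}"
  have "inj_on f S"
  proof (rule inj_onI)
    fix x y assume "x \<in> S" "y \<in> S" and eq: "f x = f y"
    have "a * (int x - int y) = q * (b x - b y)"
      using eq by (simp add: f_def algebra_simps)
    then have "q dvd a * (int x - int y)" by simp
    then have "q dvd int x - int y"
      using assms(1) by (metis coprime_commute coprime_dvd_mult_right_iff)
    then have "int x mod q = int y mod q" by (simp add: mod_eq_dvd_iff)
    moreover have "int x div q = int y div q" using eq by (simp add: f_def)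
    ultimately have "int x = int y" by (metis div_mult_mod_eq)
    then show "x = y" by simp
  qed
  moreover have "f ` S \<subseteq> T"
  proof
    fix z assume "z \<in> f ` S"
    then obtain m where m: "m \<in> S" "z = f m" by auto
    have "int m div q \<le> int M div q"
      using m assms(2) by (intro zdiv_mono1) (auto simp: S_def)
    moreover have "0 \<le> int m div q" using assms(2) by (simp add: pos_imp_zdiv_nonneg_iff)
    moreover have "a * int m - b m * q \<le> \<lfloor>r\<rfloor>" "- \<lfloor>r\<rfloor> \<le> a * int m - b m * q"
      using b[OF m(1)] by linarith+
    ultimately show "z \<in> T" using m by (simp add: f_def T_def)
  qed
  moreover have "finite T" by (simp add: T_def)
  ultimately have "card S \<le> card T" by (metis card_inj_on_le)
  also have "real (card T) = (real_of_int (int M div q) + 1) * (2 * real_of_int \<lfloor>r\<rfloor> + 1)"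
  proof -
    have "0 \<le> int M div q" "0 \<le> \<lfloor>r\<rfloor>" using assms by (auto simp: pos_imp_zdiv_nonneg_iff)
    then show ?thesis by (simp add: T_def card_cartesian_product)
  qed
  also have "\<dots> \<le> (M / q + 1) * (2 * r + 1)"
  proof (intro mult_mono)
    show "real_of_int (int M div q) + 1 \<le> M / q + 1"
      using real_of_int_div4[of "int M" q] by simp
  qed (use assms in \<open>auto\<close>)
  finally show ?thesis by simp
qed

text \<open>A pair \<open>(p, k)\<close> with \<open>k \<le> D < p\<close> is determined by \<open>p * k\<close>, since \<open>p\<close> is its only prime factor
  exceeding \<open>D\<close>; so if every product were at most \<open>M\<close>, there would be too few of them.\<close>

lemma Dirichlet_approx_large_denominator:
  fixes a q :: int and D M :: nat and P :: "nat set"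
  assumes "coprime a q" "q > 0" "D > 0"
    and P: "\<And>p. p \<in> P \<Longrightarrow> prime p \<and> p > D"
    and card: "(M / q + 1) * (2 * (q / D) + 1) < card P"
  obtains p k h where "p \<in> P" "0 < k" "k \<le> D" "p * k > M"
    "\<bar>real (p * k) * (a / q) - real_of_int h\<bar> < 1 / D"
proof -
  have "\<exists>k h. 0 < k \<and> k \<le> D \<and> \<bar>real k * (p * (a / q)) - real_of_int h\<bar> < 1 / D" for p :: nat
  proof -
    obtain h k where "0 < k" "k \<le> int D" "\<bar>of_int k * (p * (a / q)) - of_int h\<bar> < 1 / D"
      using Dirichlet_approx[OF \<open>D > 0\<close>] by metis
    then show ?thesis by (intro exI[of _ "nat k"] exI[of _ h]) auto
  qed
  then obtain k h where k: "0 < k p" "k p \<le> D"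
    and h: "\<bar>real (k p) * (p * (a / q)) - real_of_int (h p)\<bar> < 1 / D" for p :: nat
    by metis
  have "\<exists>p\<in>P. p * k p > M"
  proof (rule ccontr)
    assume "\<not> ?thesis"
    then have le: "p * k p \<le> M" if "p \<in> P" for p using that by (meson not_le)
    let ?S = "{m \<in> {1..M}. \<exists>b. \<bar>real_of_int (a * int m - b * q)\<bar> \<le> q / D}"
    have "inj_on (\<lambda>p. p * k p) P"
    proof (rule inj_onI)
      fix x y assume "x \<in> P" "y \<in> P" and eq: "x * k x = y * k y"
      then have x: "prime x" "x > D" and y: "prime y" "y > D" using P by auto
      have "x dvd y * k y" using eq by (metis dvd_triv_left)
      moreover have "\<not> x dvd k y" using k[of y] x by (auto dest: dvd_imp_le)
      ultimately have "x dvd y" using x by (simp add: prime_dvd_mult_iff)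
      then show "x = y" using x y by (simp add: primes_dvd_imp_eq)
    qed
    moreover have "(\<lambda>p. p * k p) ` P \<subseteq> ?S"
    proof
      fix m assume "m \<in> (\<lambda>p. p * k p) ` P"
      then obtain p where p: "p \<in> P" "m = p * k p" by auto
      \<comment> \<open>Multiplying Dirichlet's inequality by \<open>q\<close> puts
        \<open>a * m\<close> within \<open>q / D\<close> of the multiple
        \<open>h p * q\<close>.\<close>
      have "real_of_int (a * int m - h p * q) = q * (real (k p) * (p * (a / q)) - real_of_int (h p))"
        using \<open>q > 0\<close> p by (simp add: field_simps)
      also have "\<bar>\<dots>\<bar> \<le> q * (1 / D)"
        using h[of p] \<open>q > 0\<close> unfolding abs_mult by (intro mult_mono) auto
      finally have "\<exists>b. \<bar>real_of_int (a * int m - b * q)\<bar> \<le> q / D" by auto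
      moreover have "m \<ge> 1" using p k(1)[of p] P[of p] by (simp add: Suc_le_eq)
      ultimately show "m \<in> ?S" using le[OF p(1)] p by auto
    qed
    ultimately have "card P \<le> card ?S" by (rule card_inj_on_le) simp
    also have "real (card ?S) \<le> (M / q + 1) * (2 * (q / D) + 1)"
      using assms by (intro card_multiples_near_zero_mod) auto
    finally show False using card by linarith
  qed
  then obtain p where "p \<in> P" "p * k p > M" by blast
  then show ?thesis using k[of p] h[of p] that[of p "k p" "h p"] by (simp add: mult_ac)
qed

section \<open>Splitting the fraction, choice of parameters and assembly\<close>

text \<open>Multiply a Bezout identity \<open>x * p + y * k = 1\<close> by
  \<open>h / (p * k)\<close>.\<close>

lemma fraction_coprime_denominators:
  fixes h p k :: int
  assumes "coprime p k" "p > 0" "k > 0"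
  obtains a1 a2 :: int where "h / (p * k) = a1 / p + a2 / k"
proof -
  obtain x y where "x * p + y * k = 1"
    using assms bezout_int[of p k] by auto
  then have "real_of_int h = real_of_int h * (x * p + y * k)" by (metis mult.right_neutral of_int_1)
  then have "real_of_int h / (p * k) = (h * y) / p + (h * x) / k"
    using assms by (simp add: field_simps)
  then show ?thesis using that[of "h * y" "h * x"] by simp
qed

text \<open>These conditions say that \<open>N\<close> is large enough. With
  \<open>X = N powr (1 - \<delta>)\<close>, the first makes rounding \<open>X\<close> down lose at
  most a factor 2; the second makes the primes up to \<open>N\<close> outnumber the candidates, as a
  power below 1 is beaten by \<open>N / ln N\<close>.\<close>

lemma eventually_powr_lt_card_primes_bound:
  fixes \<delta> :: real
  assumes "0 < \<delta>" "\<delta> < 1"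
  shows "\<forall>\<^sub>F N :: real in at_top. 2 \<le> N powr (1 - \<delta>) \<and>
    11 * N powr (1 - \<delta>) < (N / 2 - 1) * ln 2 / ln N"
proof (intro eventually_conj)
  show "\<forall>\<^sub>F N :: real in at_top. 2 \<le> N powr (1 - \<delta>)"
    using assms by real_asymp
  show "\<forall>\<^sub>F N :: real in at_top. 11 * N powr (1 - \<delta>) < (N / 2 - 1) * ln 2 / ln N"
    using assms by real_asymp
qed

lemma approx_by_two_fractions:
  fixes a q :: int and N \<delta> :: real
  assumes "0 < \<delta>" "\<delta> \<le> 1/4" "N \<ge> 2" "coprime a q" "N < q" "q \<le> N powr (3/2)"
    and D2: "2 \<le> N powr (1 - \<delta>)"
    and bound: "11 * N powr (1 - \<delta>) < (N / 2 - 1) * ln 2 / ln N"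
  obtains a1 a2 q1 q2 :: int where "1 \<le> q1" "q1 \<le> N" "1 \<le> q2" "q2 \<le> N"
    "\<bar>a / q - a1 / q1 - a2 / q2\<bar> \<le> 2 / N powr (3 - 3 * \<delta>)"
proof -
  define D where "D = nat \<lfloor>N powr (1 - \<delta>)\<rfloor>"
  define M where "M = nat \<lfloor>N powr (2 - 2 * \<delta>)\<rfloor>"
  define Q where "Q = {p :: nat. prime p \<and> real p \<le> N}"
  define P where "P = Q - {..D}"
  have q: "q > 0" using assms by linarith
  have D: "D > 0" "D \<le> N powr (1 - \<delta>)" "N powr (1 - \<delta>) / 2 \<le> D"
    using D2 unfolding D_def by linarith+
  have M: "M \<le> N powr (2 - 2 * \<delta>)" "N powr (2 - 2 * \<delta>) < M + 1"
    unfolding M_def by (auto simp: of_nat_floor) linarith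
  have "N powr (1 - \<delta>) \<le> N powr 1"
    using assms by (intro powr_mono) auto
  then have DN: "D \<le> N" using D assms by simp
  have count: "(M / q + 1) * (2 * (q / D) + 1) < card P"
  proof -
    have "M / D \<le> N powr (2 - 2 * \<delta>) / (N powr (1 - \<delta>) / 2)"
      using D D2 M by (intro frac_le) auto
    also have "\<dots> = 2 * N powr (2 - 2 * \<delta> - (1 - \<delta>))"
      by (simp only: powr_diff) simp
    finally have 1: "M / D \<le> 2 * N powr (1 - \<delta>)" by (simp add: algebra_simps)
    have "M / q \<le> N powr (2 - 2 * \<delta>) / N powr 1"
      using M assms by (intro frac_le) auto
    also have "\<dots> = N powr (1 - 2 * \<delta>)"
      by (simp only: powr_diff[symmetric]) simp
    also have "\<dots> \<le> N powr (1 - \<delta>)"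
      using assms by (intro powr_mono) auto
    finally have 2: "M / q \<le> N powr (1 - \<delta>)" .
    have "q / D \<le> N powr (3/2) / (N powr (1 - \<delta>) / 2)"
      using D D2 assms by (intro frac_le) auto
    also have "\<dots> = 2 * N powr (3/2 - (1 - \<delta>))"
      by (simp only: powr_diff) simp
    \<comment> \<open>The exponents compare as \<open>1/2 + \<delta> \<le> 1 - \<delta>\<close>,
      which is where \<open>\<delta> \<le> 1/4\<close> enters.\<close>
    also have "\<dots> \<le> 2 * N powr (1 - \<delta>)"
      using assms by (intro mult_left_mono powr_mono) auto
    finally have 3: "q / D \<le> 2 * N powr (1 - \<delta>)" .
    have "(M / q + 1) * (2 * (q / D) + 1) = 2 * (M / D) + M / q + 2 * (q / D) + 1"
      using q D by (simp add: field_simps)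
    \<comment> \<open>In units of \<open>N powr (1 - \<delta>)\<close> the four terms are at most 4,
      1, 4 and 1. One more unit, making 11, pays for discarding the primes up to
      \<open>D\<close>.\<close>
    also have "\<dots> < (N / 2 - 1) * ln 2 / ln N - N powr (1 - \<delta>)"
      using 1 2 3 bound D2 by linarith
    also have "\<dots> \<le> real (card Q) - real D"
      using card_primes_lower_bound[of N] assms D unfolding Q_def by linarith
    also have "\<dots> \<le> real (card P)"
    proof -
      \<comment> \<open>Leaving out 0, which is not prime, makes the removed set have exactly
        \<open>D\<close> elements.\<close>
      have "Q - {..D} = Q - {1..D}" by (auto simp: Q_def dest: prime_ge_1_nat)
      then show ?thesis using diff_card_le_card_Diff[of "{1..D}" Q] unfolding P_def by simp
    qed
    finally show ?thesis .
  qed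
  obtain p k h where p: "p \<in> P" and k: "0 < k" "k \<le> D" and pk: "p * k > M"
    and h: "\<bar>real (p * k) * (a / q) - real_of_int h\<bar> < 1 / D"
    by (rule Dirichlet_approx_large_denominator[OF \<open>coprime a q\<close> q D(1) _ count])
       (auto simp: P_def Q_def)
  have p': "prime p" "D < p" "p \<le> N" using p by (auto simp: P_def Q_def)
  then have "\<not> p dvd k" using k by (auto dest: dvd_imp_le)
  then have "coprime (int p) (int k)" using p' by (simp add: prime_imp_coprime)
  then obtain a1 a2 :: int where split: "h / (int p * int k) = a1 / int p + a2 / int k"
    using fraction_coprime_denominators[of "int p" "int k" h] p' k by (metis of_nat_0_less_iff prime_gt_0_nat)
  have "a / q - a1 / int p - a2 / int k = (real (p * k) * (a / q) - real_of_int h) / real (p * k)"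
    using split p' k by (simp add: field_simps)
  also have "\<bar>\<dots>\<bar> = \<bar>real (p * k) * (a / q) - real_of_int h\<bar> / real (p * k)"
    by (simp only: abs_divide abs_of_nat)
  also have "\<dots> \<le> (1 / (N powr (1 - \<delta>) / 2)) / N powr (2 - 2 * \<delta>)"
  proof (rule frac_le)
    have "1 / real D \<le> 1 / (N powr (1 - \<delta>) / 2)"
      using D D2 by (intro frac_le) auto
    then show "\<bar>real (p * k) * (a / q) - real_of_int h\<bar> \<le> 1 / (N powr (1 - \<delta>) / 2)"
      using h by linarith
    \<comment> \<open>Integrality turns \<open>p * k > M\<close> into
      \<open>p * k \<ge> M + 1\<close>, which undoes the rounding in \<open>M\<close>.\<close>
    have "real M + 1 \<le> real (p * k)" using pk by linarith
    then show "N powr (2 - 2 * \<delta>) \<le> real (p * k)" using M(2) by linarith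
  qed (use assms in auto)
  also have "\<dots> = 2 / (N powr (1 - \<delta>) * N powr (2 - 2 * \<delta>))" by simp
  also have "\<dots> = 2 / N powr (3 - 3 * \<delta>)"
    by (simp add: powr_add[symmetric])
  finally show ?thesis
    using p' k DN by (intro that[of "int p" "int k" a1 a2]) auto
qed

theorem theorem6:
  fixes \<epsilon> :: real
  assumes "\<epsilon> > 0"
  shows "\<exists>C :: real. C > 0 \<and>
    (\<forall>(N :: real) (\<alpha> :: real) (a :: int) (q :: int).
      N \<ge> 1 \<longrightarrow> 1 \<le> q \<longrightarrow> real_of_int q \<le> N powr (3/2) \<longrightarrow> coprime a q \<longrightarrow>
      \<bar>\<alpha> - real_of_int a / real_of_int q\<bar> \<le> 1 / (real_of_int q * N powr (3/2)) \<longrightarrow>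
      (\<exists>(a1 :: int) (a2 :: int) (q1 :: int) (q2 :: int).
        1 \<le> q1 \<and> real_of_int q1 \<le> N \<and> 1 \<le> q2 \<and> real_of_int q2 \<le> N \<and>
        \<bar>\<alpha> - real_of_int a1 / real_of_int q1 - real_of_int a2 / real_of_int q2\<bar>
          \<le> C / (real_of_int q * N powr (3/2 - \<epsilon>))))"
proof -
  \<comment> \<open>The error exponent \<open>3 - 3 * \<delta>\<close> must be at least
    \<open>3 - \<epsilon>\<close>, and the count needs \<open>\<delta> \<le> 1/4\<close>.\<close>
  define \<delta> where "\<delta> = min \<epsilon> 1 / 4"
  have \<delta>: "0 < \<delta>" "\<delta> \<le> 1/4" "3 * \<delta> \<le> \<epsilon>" using assms by (auto simp: \<delta>_def)
  obtain N0 where N0: "\<And>N. N \<ge> N0 \<Longrightarrow> 2 \<le> N powr (1 - \<delta>) \<and>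
    11 * N powr (1 - \<delta>) < (N / 2 - 1) * ln 2 / ln N"
    using eventually_powr_lt_card_primes_bound[of \<delta>] \<delta> unfolding eventually_at_top_linorder by auto
  define N1 where "N1 = max 2 N0"
  \<comment> \<open>The 3 covers an error 1 for replacing \<open>\<alpha>\<close> by
    \<open>a / q\<close> and 2 for approximating \<open>a / q\<close>, both in units of
    \<open>1 / E\<close> below; \<open>N1 powr 3\<close> absorbs every
    \<open>N < N1\<close>.\<close>
  define C where "C = 3 + N1 powr 3"
  have C: "C \<ge> 3" by (simp add: C_def)
  show ?thesis
  proof (intro exI[of _ C] conjI allI impI)
    show "C > 0" using C by linarith
    fix N \<alpha> :: real and a q :: int
    assume N: "N \<ge> 1" and q: "1 \<le> q" and qN: "real_of_int q \<le> N powr (3/2)" and cop: "coprime a q"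
      and \<alpha>: "\<bar>\<alpha> - real_of_int a / real_of_int q\<bar> \<le> 1 / (real_of_int q * N powr (3/2))"
    define E where "E = real_of_int q * N powr (3/2 - \<epsilon>)"
    have E0: "E > 0" using N q by (simp add: E_def)
    have "E \<le> q * N powr (3/2)"
      unfolding E_def using N q assms by (intro mult_left_mono powr_mono) auto
    then have \<alpha>E: "\<bar>\<alpha> - real_of_int a / real_of_int q\<bar> \<le> 1 / E"
      using \<alpha> E0 by (smt (verit) frac_le)
    consider "N < N1" | "real_of_int q \<le> N" | "N1 \<le> N" "N < real_of_int q" by linarith
    then have "\<exists>(a1 :: int) (a2 :: int) (q1 :: int) (q2 :: int).
        1 \<le> q1 \<and> real_of_int q1 \<le> N \<and> 1 \<le> q2 \<and> real_of_int q2 \<le> N \<and>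
        \<bar>\<alpha> - real_of_int a1 / real_of_int q1 - real_of_int a2 / real_of_int q2\<bar> \<le> C / E"
    proof cases
      case 1
      \<comment> \<open>For bounded \<open>N\<close> the allowed error \<open>C / E\<close> is at
        least 1, so the integer part of \<open>\<alpha>\<close> suffices.\<close>
      have "E \<le> q * N powr (3/2)" by fact
      also have "\<dots> \<le> N powr (3/2) * N powr (3/2)" using qN by (intro mult_right_mono) auto
      also have "\<dots> = N powr 3" by (simp add: powr_add[symmetric])
      also have "\<dots> \<le> N1 powr 3" using 1 N by (intro powr_mono2) auto
      finally have "1 \<le> C / E" using E0 by (simp add: C_def)
      moreover have "\<bar>\<alpha> - real_of_int \<lfloor>\<alpha>\<rfloor>\<bar> \<le> 1" by linarith
      ultimately show ?thesis
        using N by (intro exI[of _ "\<lfloor>\<alpha>\<rfloor>"] exI[of _ "0::int"] exI[of _ "1::int"]) auto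
    next
      case 2
      have "1 / E \<le> C / E" using C E0 by (simp add: divide_right_mono)
      then show ?thesis
        using 2 q N \<alpha>E by (intro exI[of _ a] exI[of _ "0::int"] exI[of _ q] exI[of _ "1::int"]) auto
    next
      case 3
      have N2: "N \<ge> 2" "N \<ge> N0" using 3 by (auto simp: N1_def)
      obtain a1 a2 q1 q2 :: int where *: "1 \<le> q1" "q1 \<le> N" "1 \<le> q2" "q2 \<le> N"
        and err: "\<bar>a / q - a1 / q1 - a2 / q2\<bar> \<le> 2 / N powr (3 - 3 * \<delta>)"
        using approx_by_two_fractions[OF \<delta>(1,2) N2(1) cop 3(2) qN] N0[OF N2(2)] by metis
      \<comment> \<open>The bound \<open>q \<le> N powr (3/2)\<close> turns an error independent of
        \<open>q\<close> into one of the required form \<open>2 / E\<close>.\<close>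
      have "E \<le> N powr (3/2) * N powr (3/2 - \<epsilon>)"
        unfolding E_def using qN by (intro mult_right_mono) auto
      also have "\<dots> = N powr (3 - \<epsilon>)" by (simp add: powr_add[symmetric])
      also have "\<dots> \<le> N powr (3 - 3 * \<delta>)" using \<delta> N by (intro powr_mono) auto
      finally have "2 / N powr (3 - 3 * \<delta>) \<le> 2 / E"
        using E0 by (intro frac_le) auto
      then have "\<bar>\<alpha> - a1 / q1 - a2 / q2\<bar> \<le> 1 / E + 2 / E" using err \<alpha>E by linarith
      also have "\<dots> \<le> C / E" using C E0 by (simp add: add_divide_distrib[symmetric] divide_right_mono)
      finally show ?thesis using * by blast
    qed
    then show "\<exists>(a1 :: int) (a2 :: int) (q1 :: int) (q2 :: int).
        1 \<le> q1 \<and> real_of_int q1 \<le> N \<and> 1 \<le> q2 \<and> real_of_int q2 \<le> N \<and>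
        \<bar>\<alpha> - real_of_int a1 / real_of_int q1 - real_of_int a2 / real_of_int q2\<bar>
          \<le> C / (real_of_int q * N powr (3/2 - \<epsilon>))"
      unfolding E_def .
  qed
qed

end
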